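(* Let $k$ be an admissible kernel, and let there exist a nondecreasing function $\varphi\colon(0,\infty)\to(0,\infty)$ such that $K_k\colon L^\infty\to m_\varphi$ and $K_k\colon L^1\to L^\infty$. Then for every $f\in L^1+L^\infty$ we have $$(K_kf)^*(t)\le C\int_0^{1/\varphi(t)}f^*(s)\,ds\quad\text{for a.e. }t\in(0,\infty),$$ where $C=\max\{\|K_k\|_{L^\infty\to m_\varphi},\|K_k\|_{L^1\to L^\infty}\}$. Furthermore, if $\varphi$ is right-continuous on $(0,\infty)$, this inequality holds for every $t\in(0,\infty)$.
   Context: All function spaces are over $(0,\infty)$ with Lebesgue measure $\lambda$, $L^p=L^p(0,\infty)$; $\mathcal M(0,\infty)$ denotes the set of measurable $f\colon(0,\infty)\to[-\infty,\infty]$. Convention: $0\cdot\infty=0$. The nonincreasing rearrangement of $f\in\mathcal M(0,\infty)$ is $f^*(x):=\inf\{t\in[0,\infty):\lambda(\{y\in(0,\infty):|f(y)|>t\})\le x\}$, $x\in[0,\infty)$. For a nondecreasing $\varphi\colon(0,\infty)\to(0,\infty)$ put $\|f\|_{m_\varphi}:=\operatorname{ess\,sup}_{t\in(0,\infty)}\varphi(t)f^*(t)$ and $m_\varphi:=\{f\in\mathcal M(0,\infty):\|f\|_{m_\varphi}<\infty\}$ (this need not be a linear space, nor $\|\cdot\|_{m_\varphi}$ a quasinorm). An admissible kernel is a measurable function $k\colon(0,\infty)\times(0,\infty)\to[0,\infty]$ such that $k(\cdot,t)$ is integrable on $(0,\infty)$ for a.e. $t\in(0,\infty)$. The associated operator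 is $K_kf(t):=\int_0^\infty f(s)k(s,t)\,ds$, $t\in(0,\infty)$, for every $f\in\mathcal M(0,\infty)$ for which the integral makes sense. $T\colon X\to Y$ means that $T$ is bounded from $X$ to $Y$, i.e. $\|T\|_{X\to Y}:=\sup\{\|Tf\|_Y: f\in X,\ \|f\|_X\le1\}<\infty$. *)

theory Defs
  imports "HOL-Analysis.Analysis" "HOL-Probability.Essential_Supremum"
begin

text \<open>Functions on \<open>(0,\<infinity>)\<close> are represented by total functions on \<^typ>\<open>real\<close>; their values
  outside \<open>(0,\<infinity>)\<close> never matter, since everything is relative to the following measure.\<close>

abbreviation halfline :: "real measure" where
  "halfline \<equiv> lebesgue_on {0<..}"

definition measurable_functions :: "(real \<Rightarrow> ereal) set" where
  "measurable_functions = borel_measurable halfline"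

text \<open>Nonincreasing rearrangement. The infimum is taken in \<open>[0,\<infinity>]\<close>, so that
  it is \<open>\<infinity>\<close> when no finite \<open>t\<close> qualifies.\<close>

definition rearr :: "(real \<Rightarrow> ereal) \<Rightarrow> real \<Rightarrow> ennreal" where
  "rearr f x = Inf {ennreal t | t. 0 \<le> t \<and>
     emeasure halfline {y \<in> {0<..}. \<bar>f y\<bar> > ereal t} \<le> ennreal x}"

definition L1_norm :: "(real \<Rightarrow> ereal) \<Rightarrow> ennreal" where
  "L1_norm f = (\<integral>\<^sup>+ x. e2ennreal \<bar>f x\<bar> \<partial>halfline)"

definition Linf_norm :: "(real \<Rightarrow> ereal) \<Rightarrow> ennreal" where
  "Linf_norm f = esssup halfline (\<lambda>x. e2ennreal \<bar>f x\<bar>)"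

definition m_norm :: "(real \<Rightarrow> real) \<Rightarrow> (real \<Rightarrow> ereal) \<Rightarrow> ennreal" where
  "m_norm \<phi> f = esssup halfline (\<lambda>t. ennreal (\<phi> t) * rearr f t)"

text \<open>The function space determined by a (not necessarily subadditive) functional: \<open>L\<^sup>1\<close>,
  \<open>L\<^sup>\<infinity>\<close> and \<open>m\<^sub>\<phi>\<close> all arise in this way.\<close>

definition fun_space :: "((real \<Rightarrow> ereal) \<Rightarrow> ennreal) \<Rightarrow> (real \<Rightarrow> ereal) set" where
  "fun_space N = {f \<in> measurable_functions. N f < \<infinity>}"

text \<open>As usual, the decomposition is one of functions modulo null sets; in particular points
  at which the sum is of the form \<open>\<infinity> - \<infinity>\<close> are irrelevant, as \<open>h\<close> is finite a.e.\<close>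

definition L1_plus_Linf :: "(real \<Rightarrow> ereal) set" where
  "L1_plus_Linf = {f \<in> measurable_functions. \<exists>g \<in> fun_space L1_norm. \<exists>h \<in> fun_space Linf_norm.
     AE x in halfline. f x = g x + h x}"

text \<open>Lebesgue integral of an extended real-valued function. The coercion \<^const>\<open>e2ennreal\<close>
  sends negative numbers to \<open>0\<close>, so the two integrals are those of the positive and
  the negative part. The integral makes sense if at least one of them is finite.\<close>

definition ext_integral :: "'a measure \<Rightarrow> ('a \<Rightarrow> ereal) \<Rightarrow> ereal" where
  "ext_integral M g =
     enn2ereal (\<integral>\<^sup>+ x. e2ennreal (g x) \<partial>M) - enn2ereal (\<integral>\<^sup>+ x. e2ennreal (- g x) \<partial>M)"

definition ext_integral_exists :: "'a measure \<Rightarrow> ('a \<Rightarrow> ereal) \<Rightarrow> bool" where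
  "ext_integral_exists M g \<longleftrightarrow> g \<in> borel_measurable M \<and>
     ((\<integral>\<^sup>+ x. e2ennreal (g x) \<partial>M) < \<infinity> \<or> (\<integral>\<^sup>+ x. e2ennreal (- g x) \<partial>M) < \<infinity>)"

definition admissible_kernel :: "(real \<times> real \<Rightarrow> ennreal) \<Rightarrow> bool" where
  "admissible_kernel k \<longleftrightarrow>
     k \<in> borel_measurable (lebesgue_on ({0<..} \<times> {0<..})) \<and>
     (AE t in halfline. (\<lambda>s. k (s, t)) \<in> borel_measurable halfline \<and>
        (\<integral>\<^sup>+ s. k (s, t) \<partial>halfline) < \<infinity>)"

definition kernel_op :: "(real \<times> real \<Rightarrow> ennreal) \<Rightarrow> (real \<Rightarrow> ereal) \<Rightarrow> real \<Rightarrow> ereal" where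
  "kernel_op k f t = ext_integral halfline (\<lambda>s. f s * enn2ereal (k (s, t)))"

text \<open>Since \<open>k(\<cdot>,t)\<close> is integrable for almost every \<open>t\<close> only, \<open>K\<^sub>k f\<close> is a function defined almost
  everywhere; the values of \<^const>\<open>kernel_op\<close> on the exceptional null set are immaterial.\<close>

definition kernel_op_defined :: "(real \<times> real \<Rightarrow> ennreal) \<Rightarrow> (real \<Rightarrow> ereal) \<Rightarrow> bool" where
  "kernel_op_defined k f \<longleftrightarrow>
     (AE t in halfline. ext_integral_exists halfline (\<lambda>s. f s * enn2ereal (k (s, t))))"

definition op_norm ::
  "((real \<Rightarrow> ereal) \<Rightarrow> ennreal) \<Rightarrow> ((real \<Rightarrow> ereal) \<Rightarrow> ennreal) \<Rightarrow>
     ((real \<Rightarrow> ereal) \<Rightarrow> real \<Rightarrow> ereal) \<Rightarrow> ennreal" where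
  "op_norm NX NY T = (SUP f \<in> {f \<in> fun_space NX. NX f \<le> 1}. NY (T f))"

text \<open>\<open>K\<^sub>k : X \<rightarrow> Y\<close>, i.e. \<open>K\<^sub>k\<close> is defined on \<open>X\<close>, takes values in \<open>Y\<close> and is bounded.\<close>

definition kernel_op_bounded ::
  "(real \<times> real \<Rightarrow> ennreal) \<Rightarrow> ((real \<Rightarrow> ereal) \<Rightarrow> ennreal) \<Rightarrow> ((real \<Rightarrow> ereal) \<Rightarrow> ennreal) \<Rightarrow> bool" where
  "kernel_op_bounded k NX NY \<longleftrightarrow>
     (\<forall>f \<in> fun_space NX. kernel_op_defined k f \<and> kernel_op k f \<in> fun_space NY) \<and>
     op_norm NX NY (kernel_op k) < \<infinity>"

end

theory Submission
  imports Defs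
begin

text \<open>Fix \<open>t\<close>, put \<open>r = 1 / \<phi> t\<close> and \<open>a = f\<^sup>* r\<close>, and cut \<open>\<bar>f\<bar>\<close> at height \<open>a\<close>. The positive
  kernel maps the upper part \<open>(\<bar>f\<bar> - a)\<^sup>+\<close> to a function bounded by \<open>C\<close> times its \<open>L\<^sup>1\<close> norm, and
  the lower part to a function dominated by \<open>a * K 1\<close>, where \<open>(K 1)\<^sup>* t \<le> C * r\<close>. Hence, outside
  a set of measure \<open>t\<close>, \<open>\<bar>K f\<bar>\<close> is at most \<open>C\<close> times \<open>\<integral> (\<bar>f\<bar> - a)\<^sup>+ + a * r\<close>, and by the layer cake
  formula that sum is the integral of \<open>f\<^sup>*\<close> over \<open>(0, r)\<close>. Comparing the lower parts with
  \<open>a * K 1\<close>, rather than applying the weak-type bound to each of them, keeps the exceptional null set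
  independent of \<open>t\<close>.\<close>

section \<open>Distribution functions and decreasing rearrangements over a general measure\<close>

definition distr_fun :: "'a measure \<Rightarrow> ('a \<Rightarrow> ennreal) \<Rightarrow> ennreal \<Rightarrow> ennreal" where
  "distr_fun M F \<tau> = emeasure M {y \<in> space M. \<tau> < F y}"

text \<open>In contrast to \<open>rearr\<close>, the infimum runs over all levels in
  \<open>ennreal\<close>. The level \<open>top\<close> always qualifies, so the set of levels is
  never empty.\<close>

definition decr_rearr :: "'a measure \<Rightarrow> ('a \<Rightarrow> ennreal) \<Rightarrow> ennreal \<Rightarrow> ennreal" where
  "decr_rearr M F x = Inf {\<tau>. distr_fun M F \<tau> \<le> x}"

lemma distr_fun_antimono:
  assumes [measurable]: "F \<in> borel_measurable M" and "\<sigma> \<le> \<tau>"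
  shows "distr_fun M F \<tau> \<le> distr_fun M F \<sigma>"
  unfolding distr_fun_def using assms(2) by (intro emeasure_mono) auto

text \<open>The infimum is attained: along levels decreasing to it, the superlevel sets increase to
  the superlevel set at the limit, and continuity from below applies.\<close>

lemma distr_fun_decr_le:
  assumes [measurable]: "F \<in> borel_measurable M"
  shows "distr_fun M F (decr_rearr M F x) \<le> x"
proof -
  have "top \<in> {\<tau>. distr_fun M F \<tau> \<le> x}"
    by (simp add: distr_fun_def)
  then obtain u :: "nat \<Rightarrow> ennreal" where u: "decseq u" "range u \<subseteq> {\<tau>. distr_fun M F \<tau> \<le> x}"
      "Inf {\<tau>. distr_fun M F \<tau> \<le> x} = (INF i. u i)"
    using ennreal_Inf_countable_INF by (metis empty_iff)
  have "{y \<in> space M. decr_rearr M F x < F y} = (\<Union>n. {y \<in> space M. u n < F y})"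
    by (auto simp: decr_rearr_def u(3) INF_less_iff)
  moreover have "emeasure M (\<Union>n. {y \<in> space M. u n < F y}) = (SUP n. distr_fun M F (u n))"
    unfolding distr_fun_def using u(1)
    by (subst SUP_emeasure_incseq) (auto simp: incseq_def decseq_def intro: le_less_trans)
  ultimately show ?thesis
    using u(2) by (auto simp: distr_fun_def intro!: SUP_least)
qed

text \<open>A Galois connection between the two monotone functions. Later arguments bound the
  rearrangement through it, by estimating the measure of a single superlevel set; it also encodes
  right continuity.\<close>

lemma decr_le_iff:
  assumes "F \<in> borel_measurable M"
  shows "decr_rearr M F x \<le> \<tau> \<longleftrightarrow> distr_fun M F \<tau> \<le> x"
proof
  assume "decr_rearr M F x \<le> \<tau>"
  then show "distr_fun M F \<tau> \<le> x"
    using distr_fun_antimono[OF assms] distr_fun_decr_le[OF assms] order_trans by blast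
qed (auto simp: decr_rearr_def intro: Inf_lower)

lemma borel_measurable_decr:
  assumes "F \<in> borel_measurable M"
  shows "(\<lambda>s. decr_rearr M F (ennreal s)) \<in> borel_measurable borel"
proof (rule borel_measurableI_le)
  fix \<tau>
  have [measurable]: "ennreal \<in> borel_measurable borel" by simp
  show "{x \<in> space borel. decr_rearr M F (ennreal x) \<le> \<tau>} \<in> sets borel"
    by (simp only: decr_le_iff[OF assms]) measurable
qed

section \<open>Layer cake formula and the integral of the rearrangement\<close>

text \<open>Tonelli applied to the region under the graph of \<open>G\<close>: its vertical sections
  have length \<open>G y\<close>, its horizontal sections are the superlevel sets.\<close>

lemma nn_integral_layer_cake:
  assumes "sigma_finite_measure M" and [measurable]: "G \<in> borel_measurable M"
  shows "(\<integral>\<^sup>+ y. G y \<partial>M) = (\<integral>\<^sup>+ \<tau> \<in> {0<..}. distr_fun M G (ennreal \<tau>) \<partial>lborel)"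
proof -
  interpret M: sigma_finite_measure M by fact
  interpret pair_sigma_finite M lborel ..
  have *: "emeasure lborel {\<tau>. 0 < \<tau> \<and> ennreal \<tau> < c} = c" for c :: ennreal
  proof (cases c)
    case (real r)
    have "{\<tau>. 0 < \<tau> \<and> ennreal \<tau> < c} = {0<..<r}"
      using real by (auto simp: ennreal_less_iff)
    then show ?thesis using real by simp
  next
    case top
    have "{\<tau>::real. 0 < \<tau> \<and> ennreal \<tau> < c} = {0<..}"
      using top by auto
    moreover have "emeasure lborel {0::real<..} = \<infinity>"
    proof -
      have "ennreal (real n) \<le> emeasure lborel {0::real<..}" for n
      proof -
        have "ennreal (real n) = emeasure lborel {0::real<..<real n}" by simp
        also have "\<dots> \<le> emeasure lborel {0::real<..}" by (intro emeasure_mono) auto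
        finally show ?thesis .
      qed
      then show ?thesis
        by (metis ennreal_Ex_less_of_nat ennreal_of_nat_eq_real_of_nat infinity_ennreal_def 
            less_le_not_le top.not_eq_extremum)
    qed
    ultimately show ?thesis using top by simp
  qed
  have "(\<integral>\<^sup>+ y. G y \<partial>M) = (\<integral>\<^sup>+ y. (\<integral>\<^sup>+ \<tau>. indicator {\<tau>. 0 < \<tau> \<and> ennreal \<tau> < G y} \<tau> \<partial>lborel) \<partial>M)"
    by (simp add: *)
  also have "\<dots> = (\<integral>\<^sup>+ y. (\<integral>\<^sup>+ \<tau>. (if 0 < \<tau> \<and> ennreal \<tau> < G y then 1 else 0) \<partial>lborel) \<partial>M)"
    by (intro nn_integral_cong) (auto simp: indicator_def)
  also have "\<dots> = (\<integral>\<^sup>+ \<tau>. (\<integral>\<^sup>+ y. (if 0 < \<tau> \<and> ennreal \<tau> < G y then 1 else 0) \<partial>M) \<partial>lborel)"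
    by (rule Fubini'[symmetric]) measurable
  also have "\<dots> = (\<integral>\<^sup>+ \<tau> \<in> {0<..}. distr_fun M G (ennreal \<tau>) \<partial>lborel)"
  proof (intro nn_integral_cong)
    fix \<tau> :: real
    have "(\<integral>\<^sup>+ y. (if 0 < \<tau> \<and> ennreal \<tau> < G y then 1 else 0) \<partial>M)
       = (\<integral>\<^sup>+ y. indicator {y \<in> space M. 0 < \<tau> \<and> ennreal \<tau> < G y} y \<partial>M)"
      by (intro nn_integral_cong) (auto simp: indicator_def)
    also have "\<dots> = distr_fun M G (ennreal \<tau>) * indicator {0<..} \<tau>"
      by (subst nn_integral_indicator) (auto simp: distr_fun_def indicator_def)
    finally show "(\<integral>\<^sup>+ y. (if 0 < \<tau> \<and> ennreal \<tau> < G y then 1 else 0) \<partial>M)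
      = distr_fun M G (ennreal \<tau>) * indicator {0<..} \<tau>" .
  qed
  finally show ?thesis .
qed

lemma sigma_finite_lebesgue: "sigma_finite_measure (lebesgue :: real measure)"
proof
  obtain A :: "real set set" where "countable A" "A \<subseteq> sets lborel" "\<Union> A = space lborel"
     "\<forall>a\<in>A. emeasure lborel a \<noteq> \<infinity>"
    using lborel.sigma_finite_countable by auto
  then show "\<exists>A::real set set. countable A \<and> A \<subseteq> sets lebesgue \<and> \<Union> A = space lebesgue \<and>
     (\<forall>a\<in>A. emeasure lebesgue a \<noteq> \<infinity>)"
    by (intro exI[of _ A]) (auto simp: subset_eq)
qed

text \<open>Finiteness of \<open>a\<close> excludes the value
  \<open>top - top = top\<close>.\<close>

lemma ennreal_less_diff_iff:
  fixes a b c :: ennreal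
  assumes "a < top"
  shows "c < b - a \<longleftrightarrow> a + c < b"
  using assms by (cases a; cases b; cases c)
    (auto simp: ennreal_minus ennreal_less_iff simp flip: ennreal_plus)

lemma decr_antimono: "x \<le> y \<Longrightarrow> decr_rearr M F y \<le> decr_rearr M F x"
  unfolding decr_rearr_def by (intro Inf_superset_mono) auto

text \<open>The excess of \<open>F\<close> over \<open>a\<close> and the excess of its rearrangement
  over \<open>a\<close> on \<open>(0, r)\<close> have the same distribution function at every
  positive level, hence the same integral by the layer cake formula. Adding \<open>a\<close> back on
  an interval of length \<open>r\<close> restores the rearrangement.\<close>

lemma nn_integral_diff_decr:
  assumes "sigma_finite_measure M" and F: "F \<in> borel_measurable M"
    and r: "0 < r" and a: "a = decr_rearr M F (ennreal r)" "a < top"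
  shows "(\<integral>\<^sup>+ y. F y - a \<partial>M) + a * ennreal r = (\<integral>\<^sup>+ s \<in> {0<..<r}. decr_rearr M F (ennreal s) \<partial>lebesgue)"
proof -
  note [measurable] = F
  define R where "R s = decr_rearr M F (ennreal s)" for s
  have [measurable]: "R \<in> borel_measurable lebesgue"
    unfolding R_def using borel_measurable_decr[OF F] by (intro measurable_completion) (simp only: measurable_lborel2)
  have [measurable]: "(\<lambda>x. x) \<in> borel_measurable (lebesgue :: real measure)"
    by (intro measurable_completion) simp
  define H where "H s = (R s - a) * indicator {0<..<r} s" for s
  have [measurable]: "H \<in> borel_measurable lebesgue"
    unfolding H_def by measurable
  have "distr_fun M (\<lambda>y. F y - a) (ennreal \<tau>) = distr_fun lebesgue H (ennreal \<tau>)" if "0 < \<tau>" for \<tau>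
  proof -
    let ?d = "distr_fun M F (a + ennreal \<tau>)"
    have "?d \<le> distr_fun M F a"
      by (intro distr_fun_antimono) auto
    also have "\<dots> \<le> ennreal r"
      unfolding a by (rule distr_fun_decr_le) fact
    finally obtain d where d: "?d = ennreal d" "0 \<le> d" "d \<le> r"
      using r by (cases ?d) (auto simp: top_unique)
    \<comment> \<open>The rearrangement exceeds \<open>a + \<tau>\<close> exactly on the points
      below \<open>d\<close>. Since \<open>d \<le> r\<close>, the cut-off at \<open>r\<close> in
      \<open>H\<close> removes none of them.\<close>
    have "{s. ennreal \<tau> < H s} = {0<..<d}"
    proof (intro set_eqI)
      fix s
      have "ennreal \<tau> < H s \<longleftrightarrow> s \<in> {0<..<r} \<and> a + ennreal \<tau> < decr_rearr M F (ennreal s)"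
        using that by (auto simp: H_def R_def indicator_def ennreal_less_diff_iff a(2))
      also have "\<dots> \<longleftrightarrow> s \<in> {0<..<r} \<and> ennreal s < ?d"
        using decr_le_iff[OF F] by (simp add: not_le[symmetric])
      also have "\<dots> \<longleftrightarrow> s \<in> {0<..<d}"
        using d by (auto simp: ennreal_less_iff)
      finally show "s \<in> {s. ennreal \<tau> < H s} \<longleftrightarrow> s \<in> {0<..<d}" by simp
    qed
    then have "distr_fun lebesgue H (ennreal \<tau>) = ?d"
      using d by (simp add: distr_fun_def)
    moreover have "distr_fun M (\<lambda>y. F y - a) (ennreal \<tau>) = ?d"
      by (simp add: distr_fun_def ennreal_less_diff_iff a(2))
    ultimately show ?thesis by simp
  qed
  then have "(\<integral>\<^sup>+ y. F y - a \<partial>M) = (\<integral>\<^sup>+ s. H s \<partial>lebesgue)"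
    by (subst nn_integral_layer_cake[OF assms(1)], measurable,
        subst nn_integral_layer_cake[OF sigma_finite_lebesgue], measurable)
      (auto intro!: nn_integral_cong simp: indicator_def)
  moreover have "a * ennreal r = (\<integral>\<^sup>+ s \<in> {0<..<r}. a \<partial>lebesgue)"
    using r by (simp add: nn_integral_cmult_indicator)
  ultimately have "(\<integral>\<^sup>+ y. F y - a \<partial>M) + a * ennreal r
      = (\<integral>\<^sup>+ s. H s + a * indicator {0<..<r} s \<partial>lebesgue)"
    by (simp add: nn_integral_add)
  also have "\<dots> = (\<integral>\<^sup>+ s \<in> {0<..<r}. decr_rearr M F (ennreal s) \<partial>lebesgue)"
  proof (intro nn_integral_cong)
    fix s
    \<comment> \<open>For \<open>s < r\<close> the rearrangement at \<open>s\<close> is at least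
      \<open>a\<close>, so the truncated subtraction is undone by adding \<open>a\<close>.\<close>
    show "H s + a * indicator {0<..<r} s = decr_rearr M F (ennreal s) * indicator {0<..<r} s"
      using decr_antimono[of "ennreal s" "ennreal r" M F]
      by (auto simp: H_def R_def indicator_def a(1) diff_add_cancel_ennreal ennreal_leI)
  qed
  finally show ?thesis .
qed

section \<open>The half-line and agreement of the two rearrangements\<close>

lemma complete_measure_halfline: "complete_measure halfline"
proof
  fix A B :: "real set" assume "B \<subseteq> A" "A \<in> null_sets halfline"
  then have "A \<in> null_sets lebesgue" "A \<subseteq> {0<..}"
    by (auto simp: null_sets_restrict_space)
  then have "B \<in> null_sets lebesgue" "B \<subseteq> {0<..}"
    using \<open>B \<subseteq> A\<close> completion.complete2 by blast+
  then show "B \<in> sets halfline"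
    by (auto simp: sets_restrict_space_iff)
qed

text \<open>Serves for \<open>kernel_int k F\<close>, which is only almost everywhere equal to a sum
  known to be measurable.\<close>

lemma (in complete_measure) borel_measurable_AE_cong:
  assumes [measurable]: "f \<in> borel_measurable M" and "AE x in M. f x = g x"
  shows "g \<in> borel_measurable M"
proof (rule measurableI)
  fix A :: "'b set" assume [measurable]: "A \<in> sets borel"
  show "g -` A \<inter> space M \<in> sets M"
  proof (rule in_sets_AE[of "f -` A \<inter> space M"])
    show "AE x in M. x \<in> f -` A \<inter> space M \<longleftrightarrow> x \<in> g -` A \<inter> space M"
      using assms(2) by eventually_elim auto
  qed auto
qed auto

text \<open>The two sets of levels differ only by \<open>top\<close>, which does not affect an
  infimum in \<open>ennreal\<close>, even that of the empty set.\<close>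

lemma rearr_eq_decr: "rearr f x = decr_rearr halfline (\<lambda>y. e2ennreal \<bar>f y\<bar>) (ennreal x)"
proof -
  have *: "emeasure halfline {y \<in> {0<..}. \<bar>f y\<bar> > ereal t}
     = distr_fun halfline (\<lambda>y. e2ennreal \<bar>f y\<bar>) (ennreal t)" if "0 \<le> t" for t
  proof -
    have "ereal t < \<bar>z\<bar> \<longleftrightarrow> ennreal t < e2ennreal \<bar>z\<bar>" for z
      using that by (cases z) (auto simp: ennreal_less_iff)
    then show ?thesis by (simp add: distr_fun_def)
  qed
  have "{\<tau>. distr_fun halfline (\<lambda>y. e2ennreal \<bar>f y\<bar>) \<tau> \<le> ennreal x} =
    insert top {ennreal t | t. 0 \<le> t \<and>
     emeasure halfline {y \<in> {0<..}. \<bar>f y\<bar> > ereal t} \<le> ennreal x}" (is "?L = insert top ?S")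
  proof (intro set_eqI)
    fix \<tau> show "\<tau> \<in> ?L \<longleftrightarrow> \<tau> \<in> insert top ?S"
    proof (cases \<tau>)
      case (real r)
      then show ?thesis
        using * by (auto simp del: space_restrict_space)
    qed (simp add: distr_fun_def)
  qed
  then show ?thesis
    by (simp add: rearr_def decr_rearr_def)
qed

section \<open>The kernel acting on nonnegative functions\<close>

text \<open>On nonnegative functions the integral always has a value in \<open>ennreal\<close>;
  \<open>kernel_op\<close> is the difference of two such values, for the positive and the negative
  part.\<close>

definition kernel_int :: "(real \<times> real \<Rightarrow> ennreal) \<Rightarrow> (real \<Rightarrow> ennreal) \<Rightarrow> real \<Rightarrow> ennreal" where
  "kernel_int k G t = (\<integral>\<^sup>+ s. G s * k (s, t) \<partial>halfline)"

lemma e2ennreal_mult_enn2ereal: "e2ennreal (x * enn2ereal c) = e2ennreal x * c"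
proof (cases "0 \<le> x")
  case True
  then show ?thesis
    by (metis e2ennreal_enn2ereal enn2ereal_e2ennreal times_ennreal.rep_eq)
next
  case False
  then have "x * enn2ereal c \<le> 0"
    by (simp add: ereal_mult_le_0_iff)
  then show ?thesis
    using False by (simp add: e2ennreal_neg)
qed

lemma kernel_op_eq:
  "kernel_op k f t = enn2ereal (kernel_int k (\<lambda>s. e2ennreal (f s)) t)
     - enn2ereal (kernel_int k (\<lambda>s. e2ennreal (- f s)) t)"
  by (simp add: kernel_op_def ext_integral_def kernel_int_def e2ennreal_mult_enn2ereal
      flip: ereal_mult_minus_left)

lemma kernel_op_enn2ereal: "kernel_op k (\<lambda>s. enn2ereal (G s)) t = enn2ereal (kernel_int k G t)"
  by (simp add: kernel_op_eq e2ennreal_neg) (simp add: kernel_int_def zero_ennreal.rep_eq)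

lemma kernel_int_mono: "(\<And>s. G s \<le> H s) \<Longrightarrow> kernel_int k G t \<le> kernel_int k H t"
  unfolding kernel_int_def by (intro nn_integral_mono mult_right_mono) auto

text \<open>A difference of nonnegative numbers is bounded in modulus by any common upper bound, and
  both parts of \<open>f\<close> are at most \<open>\<bar>f\<bar>\<close>. In the case
  \<open>\<infinity> - \<infinity>\<close> the upper bound is itself infinite.\<close>

lemma e2ennreal_abs_kernel_op_le:
  "e2ennreal \<bar>kernel_op k f t\<bar> \<le> kernel_int k (\<lambda>s. e2ennreal \<bar>f s\<bar>) t"
proof -
  have *: "e2ennreal \<bar>enn2ereal x - enn2ereal y\<bar> \<le> z" if "x \<le> z" "y \<le> z" for x y z
    using that by (cases x; cases y; cases z) (auto simp: ennreal_le_iff)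
  have "x \<le> \<bar>x\<bar>" "- x \<le> \<bar>x\<bar>" for x :: ereal
    by (cases x; simp)+
  then show ?thesis
    unfolding kernel_op_eq by (intro * kernel_int_mono e2ennreal_mono)
qed

lemma ennreal_diff_add_min:
  fixes x c :: ennreal
  assumes "c < top"
  shows "(x - c) + min x c = x"
  using assms by (cases "x \<le> c") (auto simp: min_def diff_add_cancel_ennreal diff_eq_0_iff_ennreal)

lemma kernel_int_add:
  assumes [measurable]: "G \<in> borel_measurable halfline" "H \<in> borel_measurable halfline"
    "(\<lambda>s. k (s, t)) \<in> borel_measurable halfline"
  shows "kernel_int k (\<lambda>s. G s + H s) t = kernel_int k G t + kernel_int k H t"
  unfolding kernel_int_def by (simp add: distrib_right nn_integral_add)

lemma kernel_int_cmult:
  assumes [measurable]: "G \<in> borel_measurable halfline" "(\<lambda>s. k (s, t)) \<in> borel_measurable halfline"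
  shows "kernel_int k (\<lambda>s. c * G s) t = c * kernel_int k G t"
  unfolding kernel_int_def by (simp add: mult.assoc nn_integral_cmult)

lemma admissible_kernel_AE:
  assumes "admissible_kernel k"
  shows "AE t in halfline. (\<lambda>s. k (s, t)) \<in> borel_measurable halfline \<and>
    kernel_int k (\<lambda>_. 1) t < \<infinity>"
  using assms by (simp add: admissible_kernel_def kernel_int_def)

lemma measurable_functions_enn2ereal:
  "G \<in> borel_measurable halfline \<Longrightarrow> (\<lambda>s. enn2ereal (G s)) \<in> measurable_functions"
  by (simp add: measurable_functions_def)

lemma op_norm_upper: "f \<in> fun_space NX \<Longrightarrow> NX f \<le> 1 \<Longrightarrow> NY (T f) \<le> op_norm NX NY T"
  unfolding op_norm_def by (intro SUP_upper) auto

text \<open>Measurability comes from the mapping property: \<open>fun_space NY\<close> contains only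
  measurable functions.\<close>

lemma borel_measurable_kernel_int:
  assumes "kernel_op_bounded k NX NY" "(\<lambda>s. enn2ereal (G s)) \<in> fun_space NX"
  shows "kernel_int k G \<in> borel_measurable halfline"
proof -
  have "kernel_op k (\<lambda>s. enn2ereal (G s)) \<in> borel_measurable halfline"
    using assms by (auto simp: kernel_op_bounded_def fun_space_def measurable_functions_def)
  then have "(\<lambda>t. e2ennreal (kernel_op k (\<lambda>s. enn2ereal (G s)) t)) \<in> borel_measurable halfline"
    by (rule measurable_compose) simp
  then show ?thesis by (simp add: kernel_op_enn2ereal)
qed

lemma L1_norm_enn2ereal: "L1_norm (\<lambda>s. enn2ereal (G s)) = (\<integral>\<^sup>+ s. G s \<partial>halfline)"
  by (simp add: L1_norm_def abs_ereal_ge0)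

lemma L1_fun_space:
  assumes "G \<in> borel_measurable halfline" "(\<integral>\<^sup>+ s. G s \<partial>halfline) < \<infinity>"
  shows "(\<lambda>s. enn2ereal (G s)) \<in> fun_space L1_norm"
  using assms by (simp add: fun_space_def L1_norm_enn2ereal measurable_functions_enn2ereal)

lemma Linf_norm_enn2ereal_le:
  assumes "G \<in> borel_measurable halfline" "\<And>s. G s \<le> c"
  shows "Linf_norm (\<lambda>s. enn2ereal (G s)) \<le> c"
  unfolding Linf_norm_def using assms by (intro esssup_I) (auto simp: abs_ereal_ge0)

lemma Linf_fun_space:
  assumes "G \<in> borel_measurable halfline" "\<And>s. G s \<le> c" "c < \<infinity>"
  shows "(\<lambda>s. enn2ereal (G s)) \<in> fun_space Linf_norm"
  using Linf_norm_enn2ereal_le[OF assms(1,2)] assms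
  by (auto simp: fun_space_def measurable_functions_enn2ereal intro: le_less_trans)

section \<open>Endpoint bounds from the operator norms\<close>

text \<open>The operator norm is a supremum over the unit ball, so \<open>G\<close> is scaled to the
  function \<open>H\<close> of integral 1. A function of integral 0 cannot be scaled, but it
  vanishes almost everywhere and is mapped to 0.\<close>

lemma kernel_int_L1_bound:
  assumes k: "admissible_kernel k" and bdd: "kernel_op_bounded k L1_norm Linf_norm"
    and G [measurable]: "G \<in> borel_measurable halfline" and fin: "(\<integral>\<^sup>+ s. G s \<partial>halfline) < \<infinity>"
  shows "AE t in halfline. kernel_int k G t
    \<le> op_norm L1_norm Linf_norm (kernel_op k) * (\<integral>\<^sup>+ s. G s \<partial>halfline)"
proof (cases "(\<integral>\<^sup>+ s. G s \<partial>halfline) = 0")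
  case True
  then have "AE s in halfline. G s = 0"
    by (simp add: nn_integral_0_iff_AE)
  then have "kernel_int k G t = 0" for t
    unfolding kernel_int_def by (subst nn_integral_cong_AE[where v="\<lambda>_. 0"]) auto
  then show ?thesis by simp
next
  case False
  then obtain c where c: "(\<integral>\<^sup>+ s. G s \<partial>halfline) = ennreal c" "0 < c"
    using fin by (cases "\<integral>\<^sup>+ s. G s \<partial>halfline") (auto simp: less_le)
  define H where "H s = ennreal (1 / c) * G s" for s
  have [measurable]: "H \<in> borel_measurable halfline"
    unfolding H_def by measurable
  have G_eq: "G = (\<lambda>s. ennreal c * H s)"
    using c(2) by (simp add: H_def fun_eq_iff flip: mult.assoc ennreal_mult)
  have H_int: "(\<integral>\<^sup>+ s. H s \<partial>halfline) = 1"
    unfolding H_def using c by (simp add: nn_integral_cmult flip: ennreal_mult)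
  have "Linf_norm (kernel_op k (\<lambda>s. enn2ereal (H s))) \<le> op_norm L1_norm Linf_norm (kernel_op k)"
    using H_int by (intro op_norm_upper L1_fun_space) (auto simp: L1_norm_enn2ereal)
  moreover have "AE t in halfline. e2ennreal \<bar>kernel_op k (\<lambda>s. enn2ereal (H s)) t\<bar>
      \<le> Linf_norm (kernel_op k (\<lambda>s. enn2ereal (H s)))"
    unfolding Linf_norm_def by (rule esssup_AE)
  ultimately have "AE t in halfline. kernel_int k H t \<le> op_norm L1_norm Linf_norm (kernel_op k)"
    by (auto simp: kernel_op_enn2ereal abs_ereal_ge0)
  with admissible_kernel_AE[OF k] show ?thesis
  proof eventually_elim
    case (elim t)
    then have "kernel_int k G t = ennreal c * kernel_int k H t"
      by (subst G_eq, subst kernel_int_cmult) auto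
    then show ?case
      using elim by (simp add: c mult.commute mult_left_mono)
  qed
qed

text \<open>The definition of the norm gives this for almost every \<open>t\<close>. Since \<open>\<phi>\<close> is nondecreasing, the
  bound at points \<open>u\<close> slightly to the right of \<open>t\<close> passes to \<open>t\<close> by right continuity of the
  rearrangement.\<close>

lemma decr_kernel_int_one_le:
  assumes bdd: "kernel_op_bounded k Linf_norm (m_norm \<phi>)"
    and pos: "\<And>t. 0 < t \<Longrightarrow> 0 < \<phi> t" and mono: "mono_on {0<..} \<phi>" and t: "0 < t"
  shows "decr_rearr halfline (kernel_int k (\<lambda>_. 1)) (ennreal t)
    \<le> op_norm Linf_norm (m_norm \<phi>) (kernel_op k) * ennreal (1 / \<phi> t)"
    (is "?R t \<le> ?A * _")
proof -
  have one: "(\<lambda>s. enn2ereal 1) \<in> fun_space Linf_norm"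
    using Linf_fun_space[of "\<lambda>_. 1" 1] by simp
  have meas: "kernel_int k (\<lambda>_. 1) \<in> borel_measurable halfline"
    using borel_measurable_kernel_int[OF bdd one] .
  have "m_norm \<phi> (kernel_op k (\<lambda>s. enn2ereal 1)) \<le> ?A"
    using Linf_norm_enn2ereal_le[of "\<lambda>_. 1" 1] by (intro op_norm_upper one) auto
  moreover have "AE u in halfline. ennreal (\<phi> u) * rearr (kernel_op k (\<lambda>s. enn2ereal 1)) u
      \<le> m_norm \<phi> (kernel_op k (\<lambda>s. enn2ereal 1))"
    unfolding m_norm_def by (rule esssup_AE)
  moreover have "rearr (kernel_op k (\<lambda>s. enn2ereal 1)) u = ?R u" for u
    by (simp only: rearr_eq_decr kernel_op_enn2ereal) (simp add: abs_ereal_ge0)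
  ultimately have ae: "AE u in halfline. ennreal (\<phi> u) * ?R u \<le> ?A"
    by auto
  have "distr_fun halfline (kernel_int k (\<lambda>_. 1)) (?A * ennreal (1 / \<phi> t)) \<le> ennreal t + ennreal e"
    if e: "0 < e" for e
  proof -
    \<comment> \<open>The interval has positive length \<open>e\<close>, so it is not contained in
      the exceptional null set.\<close>
    have "\<exists>u\<in>{t<..<t+e}. ennreal (\<phi> u) * ?R u \<le> ?A"
    proof (rule ccontr)
      assume contr: "\<not> ?thesis"
      have "AE u in lebesgue. u \<in> {0<..} \<longrightarrow> ennreal (\<phi> u) * ?R u \<le> ?A"
        using ae by (simp add: AE_restrict_space_iff)
      then have "AE u in lebesgue. u \<notin> {t<..<t+e}"
        by eventually_elim (use contr t in auto)
      then have "emeasure lebesgue {t<..<t+e} = 0"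
        by (rule iffD1[OF AE_iff_measurable, rotated 2]) auto
      then show False using e by simp
    qed
    then obtain u where u: "t < u" "u < t + e" "ennreal (\<phi> u) * ?R u \<le> ?A"
      by auto
    have "\<phi> t \<le> \<phi> u"
      using mono u t by (auto simp: mono_on_def)
    then have "ennreal (\<phi> t) * ?R u \<le> ?A"
      using u(3) by (meson ennreal_leI mult_right_mono order_trans zero_le)
    then have "ennreal (\<phi> t) * ?R u * ennreal (1 / \<phi> t) \<le> ?A * ennreal (1 / \<phi> t)"
      by (intro mult_right_mono) auto
    moreover have "ennreal (\<phi> t) * ?R u * ennreal (1 / \<phi> t) = ?R u"
      using pos[OF t] by (simp add: mult.assoc mult.commute[of "?R u"])
        (simp flip: mult.assoc ennreal_mult)
    ultimately have "distr_fun halfline (kernel_int k (\<lambda>_. 1)) (?A * ennreal (1 / \<phi> t)) \<le> ennreal u"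
      by (simp add: decr_le_iff[OF meas])
    also have "\<dots> \<le> ennreal t + ennreal e"
      using u t e by (simp add: ennreal_le_iff flip: ennreal_plus)
    finally show ?thesis .
  qed
  then show ?thesis
    unfolding decr_le_iff[OF meas] by (rule ennreal_le_epsilon)
qed

section \<open>Finiteness for functions dominated by an integrable function plus a constant\<close>

text \<open>Where \<open>F\<close> exceeds \<open>c + n\<close>, the integrable \<open>G\<close> is
  at least \<open>n\<close>; by Markov's inequality this set has measure at most \<open>r\<close>
  once \<open>n\<close> is large.\<close>

lemma decr_less_top:
  assumes "F \<in> borel_measurable M" "G \<in> borel_measurable M"
    and "AE x in M. F x \<le> G x + c" "(\<integral>\<^sup>+ x. G x \<partial>M) < \<infinity>" "c < \<infinity>" "0 < r"
  shows "decr_rearr M F (ennreal r) < top"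
proof -
  note [measurable] = assms(1,2)
  obtain i where i: "(\<integral>\<^sup>+ x. G x \<partial>M) = ennreal i" "0 \<le> i"
    using assms(4) by (cases "\<integral>\<^sup>+ x. G x \<partial>M") auto
  \<comment> \<open>This choice gives \<open>i / n \<le> r\<close>; the summand 1 keeps
    \<open>n\<close> positive when \<open>i = 0\<close>.\<close>
  define n where "n = i / r + 1"
  have n: "0 < n" "1 / n * i \<le> r"
    using i(2) \<open>0 < r\<close> by (auto simp: n_def field_simps add_pos_nonneg)
  have "distr_fun M F (c + ennreal n) \<le> emeasure M {x \<in> space M. 1 \<le> ennreal (1 / n) * G x}"
    unfolding distr_fun_def
  proof (intro emeasure_mono_AE)
    show "AE x in M. x \<in> {y \<in> space M. c + ennreal n < F y} \<longrightarrow>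
        x \<in> {x \<in> space M. 1 \<le> ennreal (1 / n) * G x}"
      using assms(3)
    proof eventually_elim
      case (elim x)
      have "1 \<le> ennreal (1 / n) * G x" if "c + ennreal n < F x"
      proof -
        have "c + ennreal n < c + G x"
          using that elim by (metis add.commute less_le_trans)
        then have "ennreal n \<le> G x"
          using add_left_mono[of "G x" "ennreal n" c] by (cases "G x \<le> ennreal n") auto
        then have "ennreal (1 / n) * ennreal n \<le> ennreal (1 / n) * G x"
          by (intro mult_left_mono) auto
        then show ?thesis using n by (simp flip: ennreal_mult)
      qed
      then show ?case by auto
    qed
  qed auto
  also have "\<dots> \<le> ennreal (1 / n) * (\<integral>\<^sup>+ x. G x * indicator (space M) x \<partial>M)"
    by (rule nn_integral_Markov_inequality) auto
  also have "(\<integral>\<^sup>+ x. G x * indicator (space M) x \<partial>M) = ennreal i"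
    unfolding i(1)[symmetric] by (intro nn_integral_cong) auto
  also have "ennreal (1 / n) * ennreal i \<le> ennreal r"
    using n i by (simp add: ennreal_leI flip: ennreal_mult)
  finally have "decr_rearr M F (ennreal r) \<le> c + ennreal n"
    by (simp add: decr_le_iff[OF assms(1)])
  also have "\<dots> < top" using assms(5) by simp
  finally show ?thesis .
qed

text \<open>The excess lives on the set where \<open>F\<close> is above its rearrangement at
  \<open>r\<close>. That set has measure at most \<open>r\<close>, so the constant \<open>c\<close>
  contributes at most \<open>c * r\<close>.\<close>

lemma nn_integral_diff_decr_finite:
  assumes "F \<in> borel_measurable M" "G \<in> borel_measurable M"
    and "AE x in M. F x \<le> G x + c" "(\<integral>\<^sup>+ x. G x \<partial>M) < \<infinity>" "c < \<infinity>" "0 < r"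
  shows "(\<integral>\<^sup>+ x. F x - decr_rearr M F (ennreal r) \<partial>M) < \<infinity>"
proof -
  note [measurable] = assms(1,2)
  let ?a = "decr_rearr M F (ennreal r)"
  let ?S = "{x \<in> space M. ?a < F x}"
  have "(\<integral>\<^sup>+ x. F x - ?a \<partial>M) \<le> (\<integral>\<^sup>+ x. G x + c * indicator ?S x \<partial>M)"
  proof (rule nn_integral_mono_AE)
    show "AE x in M. F x - ?a \<le> G x + c * indicator ?S x"
      using assms(3) AE_space
    proof eventually_elim
      case (elim x)
      show ?case
      proof (cases "?a < F x")
        case True
        have "F x - ?a \<le> F x" by (rule diff_le_self_ennreal)
        also have "\<dots> \<le> G x + c" by (rule elim)
        finally show ?thesis using True elim by simp
      next
        case False
        then have "F x - ?a = 0"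
          using decr_less_top[OF assms] by (intro diff_eq_0_ennreal) auto
        then show ?thesis by simp
      qed
    qed
  qed
  also have "\<dots> = (\<integral>\<^sup>+ x. G x \<partial>M) + c * distr_fun M F ?a"
    by (simp add: nn_integral_add nn_integral_cmult_indicator distr_fun_def)
  also have "\<dots> < \<infinity>"
    using assms(4,5) distr_fun_decr_le[OF assms(1), of "ennreal r"]
    by (auto simp: ennreal_mult_less_top intro: le_less_trans)
  finally show ?thesis .
qed

section \<open>Splitting at a height, and the operator on L^1 + L^infinity\<close>

text \<open>The part of \<open>F\<close> above height \<open>c\<close> is integrable and the part
  below is bounded, so each falls under one of the two mapping properties. Almost everywhere
  finiteness follows from the bound, as the kernel has finite integral for almost every
  \<open>t\<close>.\<close>

lemma kernel_int_decomp:
  assumes k: "admissible_kernel k" "kernel_op_bounded k Linf_norm (m_norm \<phi>)"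
      "kernel_op_bounded k L1_norm Linf_norm"
    and F: "F \<in> borel_measurable halfline"
    and c: "c < \<infinity>" "(\<integral>\<^sup>+ s. F s - c \<partial>halfline) < \<infinity>"
  shows "kernel_int k F \<in> borel_measurable halfline"
    and "AE t in halfline. kernel_int k F t
      \<le> op_norm L1_norm Linf_norm (kernel_op k) * (\<integral>\<^sup>+ s. F s - c \<partial>halfline)
         + c * kernel_int k (\<lambda>_. 1) t"
    and "AE t in halfline. kernel_int k F t < \<infinity>"
proof -
  note [measurable] = F
  define G H where "G s = F s - c" and "H s = min (F s) c" for s
  have [measurable]: "G \<in> borel_measurable halfline" "H \<in> borel_measurable halfline"
    unfolding G_def H_def by measurable
  have "kernel_int k G \<in> borel_measurable halfline"
    using c(2) by (intro borel_measurable_kernel_int[OF k(3)] L1_fun_space) (auto simp: G_def[abs_def])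
  moreover have "kernel_int k H \<in> borel_measurable halfline"
    by (intro borel_measurable_kernel_int[OF k(2)] Linf_fun_space[OF _ _ c(1)]) (auto simp: H_def)
  ultimately have [measurable]: "(\<lambda>t. kernel_int k G t + kernel_int k H t) \<in> borel_measurable halfline"
    by measurable
  have sum: "AE t in halfline. kernel_int k G t + kernel_int k H t = kernel_int k F t"
    using admissible_kernel_AE[OF k(1)]
  proof eventually_elim
    case (elim t)
    then have "kernel_int k G t + kernel_int k H t = kernel_int k (\<lambda>s. G s + H s) t"
      by (simp add: kernel_int_add)
    also have "(\<lambda>s. G s + H s) = F"
      using c(1) by (auto simp: G_def H_def ennreal_diff_add_min)
    finally show ?case .
  qed
  show "kernel_int k F \<in> borel_measurable halfline"
    \<comment> \<open>Additivity is available only where \<open>k(\<cdot>, t)\<close> is measurable,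
      hence the passage through an almost everywhere equality.\<close>
    by (rule complete_measure.borel_measurable_AE_cong[OF complete_measure_halfline _ sum]) measurable
  have "AE t in halfline. kernel_int k G t
      \<le> op_norm L1_norm Linf_norm (kernel_op k) * (\<integral>\<^sup>+ s. F s - c \<partial>halfline)"
    using kernel_int_L1_bound[OF k(1,3), of G] c(2) by (simp add: G_def[abs_def])
  with sum admissible_kernel_AE[OF k(1)]
  have le: "AE t in halfline. kernel_int k F t
      \<le> op_norm L1_norm Linf_norm (kernel_op k) * (\<integral>\<^sup>+ s. F s - c \<partial>halfline)
         + c * kernel_int k (\<lambda>_. 1) t \<and> kernel_int k (\<lambda>_. 1) t < \<infinity>"
  proof eventually_elim
    case (elim t)
    \<comment> \<open>The lower part is compared pointwise with the constant
      \<open>c\<close>.\<close>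
    have "kernel_int k H t \<le> kernel_int k (\<lambda>_. c * 1) t"
      by (rule kernel_int_mono) (simp add: H_def)
    also have "\<dots> = c * kernel_int k (\<lambda>_. 1) t"
      using elim by (intro kernel_int_cmult) auto
    finally show ?case
      using elim by (auto intro: order_trans[OF _ add_mono] simp flip: elim(1))
  qed
  then show "AE t in halfline. kernel_int k F t
      \<le> op_norm L1_norm Linf_norm (kernel_op k) * (\<integral>\<^sup>+ s. F s - c \<partial>halfline)
         + c * kernel_int k (\<lambda>_. 1) t"
    by eventually_elim simp
  have B: "op_norm L1_norm Linf_norm (kernel_op k) < \<infinity>"
    using k(3) by (simp add: kernel_op_bounded_def)
  show "AE t in halfline. kernel_int k F t < \<infinity>"
    using le
  proof (eventually_elim, elim conjE)
    fix t
    assume "kernel_int k (\<lambda>_. 1) t < \<infinity>"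
      and "kernel_int k F t \<le> op_norm L1_norm Linf_norm (kernel_op k) * (\<integral>\<^sup>+ s. F s - c \<partial>halfline)
         + c * kernel_int k (\<lambda>_. 1) t"
    with B c show "kernel_int k F t < \<infinity>"
      by (auto simp: ennreal_mult_less_top elim!: le_less_trans)
  qed
qed

lemma L1_plus_Linf_dominated:
  assumes "f \<in> L1_plus_Linf"
  obtains G c where "G \<in> borel_measurable halfline" "(\<integral>\<^sup>+ s. G s \<partial>halfline) < \<infinity>" "c < \<infinity>"
    "AE s in halfline. e2ennreal \<bar>f s\<bar> \<le> G s + c"
proof -
  obtain g h where g: "g \<in> fun_space L1_norm" and h: "h \<in> fun_space Linf_norm"
    and eq: "AE x in halfline. f x = g x + h x"
    using assms by (auto simp: L1_plus_Linf_def)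
  have "AE x in halfline. e2ennreal \<bar>h x\<bar> \<le> Linf_norm h"
    unfolding Linf_norm_def by (rule esssup_AE)
  with eq have "AE s in halfline. e2ennreal \<bar>f s\<bar> \<le> e2ennreal \<bar>g s\<bar> + Linf_norm h"
  proof eventually_elim
    case (elim s)
    \<comment> \<open>The triangle inequality survives opposite infinities, because the right-hand
      side is then infinite.\<close>
    have "e2ennreal \<bar>x + y\<bar> \<le> e2ennreal \<bar>x\<bar> + e2ennreal \<bar>y\<bar>" for x y
      by (cases x; cases y) (auto simp flip: ennreal_plus intro: ennreal_leI)
    then show ?case
      using elim by (metis add_left_mono order_trans)
  qed
  moreover have "g \<in> borel_measurable halfline"
    using g by (simp add: fun_space_def measurable_functions_def)
  then have "(\<lambda>s. e2ennreal \<bar>g s\<bar>) \<in> borel_measurable halfline"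
    by measurable
  ultimately show ?thesis
    using that[of "\<lambda>s. e2ennreal \<bar>g s\<bar>" "Linf_norm h"] g h by (auto simp: fun_space_def L1_norm_def)
qed

lemma nn_integral_diff_finite:
  assumes "AE s in M. F s \<le> G s + c" "(\<integral>\<^sup>+ s. G s \<partial>M) < \<infinity>" "c < \<infinity>"
  shows "(\<integral>\<^sup>+ s. F s - c \<partial>M) < \<infinity>"
proof -
  have "(\<integral>\<^sup>+ s. F s - c \<partial>M) \<le> (\<integral>\<^sup>+ s. G s \<partial>M)"
    using assms(1,3)
    by (intro nn_integral_mono_AE) (auto simp: ennreal_minus_le_iff add.commute elim!: eventually_mono)
  then show ?thesis
    using assms(2) by (rule le_less_trans)
qed

text \<open>The positive and the negative part of \<open>f\<close> inherit the domination of
  \<open>\<bar>f\<bar>\<close>, so both can be split at the same height \<open>c\<close>.\<close>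

lemma kernel_op_L1_plus_Linf:
  assumes k: "admissible_kernel k" "kernel_op_bounded k Linf_norm (m_norm \<phi>)"
      "kernel_op_bounded k L1_norm Linf_norm"
    and f: "f \<in> L1_plus_Linf"
  shows "kernel_op_defined k f" and "kernel_op k f \<in> measurable_functions"
proof -
  have [measurable]: "f \<in> borel_measurable halfline"
    using f by (simp add: L1_plus_Linf_def measurable_functions_def)
  obtain G c where G: "G \<in> borel_measurable halfline" "(\<integral>\<^sup>+ s. G s \<partial>halfline) < \<infinity>" "c < \<infinity>"
    "AE s in halfline. e2ennreal \<bar>f s\<bar> \<le> G s + c"
    using L1_plus_Linf_dominated[OF f] .
  have abs: "x \<le> \<bar>x\<bar>" "- x \<le> \<bar>x\<bar>" for x :: ereal
    by (cases x; simp)+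
  have dom: "AE s in halfline. e2ennreal (f s) \<le> G s + c" "AE s in halfline. e2ennreal (- f s) \<le> G s + c"
    using G(4) by (eventually_elim; meson abs e2ennreal_mono order_trans)+
  note pos = kernel_int_decomp[OF k _ G(3) nn_integral_diff_finite[OF dom(1) G(2,3)]]
    and neg = kernel_int_decomp[OF k _ G(3) nn_integral_diff_finite[OF dom(2) G(2,3)]]
  have [measurable]: "kernel_int k (\<lambda>s. e2ennreal (f s)) \<in> borel_measurable halfline"
      "kernel_int k (\<lambda>s. e2ennreal (- f s)) \<in> borel_measurable halfline"
    by (intro pos neg; measurable)+
  have "(\<lambda>t. kernel_op k f t) \<in> borel_measurable halfline"
    unfolding kernel_op_eq by measurable
  then show "kernel_op k f \<in> measurable_functions"
    by (simp add: measurable_functions_def)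
  \<comment> \<open>For the integral to make sense, finiteness on the positive part is
    enough.\<close>
  have "AE t in halfline. kernel_int k (\<lambda>s. e2ennreal (f s)) t < \<infinity>"
    by (intro pos) measurable
  with admissible_kernel_AE[OF k(1)] show "kernel_op_defined k f"
    unfolding kernel_op_defined_def
  proof eventually_elim
    case (elim t)
    then have [measurable]: "(\<lambda>s. k (s, t)) \<in> borel_measurable halfline" by simp
    show ?case
      using elim by (simp add: ext_integral_exists_def e2ennreal_mult_enn2ereal kernel_int_def)
  qed
qed

section \<open>The rearrangement estimate\<close>

lemma rearr_kernel_op_le:
  assumes k: "admissible_kernel k" "kernel_op_bounded k Linf_norm (m_norm \<phi>)"
      "kernel_op_bounded k L1_norm Linf_norm"
    and \<phi>: "\<And>t. 0 < t \<Longrightarrow> 0 < \<phi> t" "mono_on {0<..} \<phi>"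
    and C: "op_norm Linf_norm (m_norm \<phi>) (kernel_op k) \<le> C" "op_norm L1_norm Linf_norm (kernel_op k) \<le> C"
    and f: "f \<in> L1_plus_Linf" and t: "0 < t"
  shows "rearr (kernel_op k f) t \<le> C * (\<integral>\<^sup>+ s \<in> {0<..<1 / \<phi> t}. rearr f s \<partial>lebesgue)"
proof -
  have [measurable]: "f \<in> borel_measurable halfline"
    using f by (simp add: L1_plus_Linf_def measurable_functions_def)
  have [measurable]: "kernel_op k f \<in> borel_measurable halfline"
    using kernel_op_L1_plus_Linf(2)[OF k f] by (simp add: measurable_functions_def)
  have one: "kernel_int k (\<lambda>_. 1) \<in> borel_measurable halfline"
    using Linf_fun_space[of "\<lambda>_. 1" 1] by (intro borel_measurable_kernel_int[OF k(2)]) simp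
  note [measurable] = one
  define F where "F s = e2ennreal \<bar>f s\<bar>" for s
  have F [measurable]: "F \<in> borel_measurable halfline"
    unfolding F_def by measurable
  define r where "r = 1 / \<phi> t"
  have r: "0 < r" using \<phi>(1)[OF t] by (simp add: r_def)
  define a where "a = decr_rearr halfline F (ennreal r)"
  \<comment> \<open>\<open>\<tau>\<close> is the claimed bound before
    \<open>nn_integral_diff_decr\<close> rewrites it. By \<open>decr_le_iff\<close> it remains to
    show that \<open>\<bar>kernel_op k f\<bar>\<close> exceeds \<open>\<tau>\<close> on a set of
    measure at most \<open>t\<close>.\<close>
  define \<tau> where "\<tau> = C * ((\<integral>\<^sup>+ s. F s - a \<partial>halfline) + a * ennreal r)"
  define q where "q = decr_rearr halfline (kernel_int k (\<lambda>_. 1)) (ennreal t)"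
  obtain G c where G: "G \<in> borel_measurable halfline" "(\<integral>\<^sup>+ s. G s \<partial>halfline) < \<infinity>" "c < \<infinity>"
    "AE s in halfline. F s \<le> G s + c"
    using L1_plus_Linf_dominated[OF f] unfolding F_def .
  have a_fin: "a < top"
    unfolding a_def using decr_less_top[OF F G(1,4,2,3) r] .
  have "(\<integral>\<^sup>+ s. F s - a \<partial>halfline) < \<infinity>"
    unfolding a_def using nn_integral_diff_decr_finite[OF F G(1,4,2,3) r] .
  note decomp = kernel_int_decomp(2)[OF k F a_fin[folded infinity_ennreal_def] this]
  have "q \<le> C * ennreal r"
    unfolding q_def r_def using decr_kernel_int_one_le[OF k(2) \<phi> t] C(1)
    by (meson mult_right_mono order_trans zero_le)
  \<comment> \<open>By contraposition: where the image of 1 is at most \<open>q\<close>, it is at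
    most \<open>C * r\<close>, and the splitting at height \<open>a\<close> bounds the image of
    \<open>F\<close> by \<open>\<tau>\<close>.\<close>
  have "AE y in halfline. \<tau> < e2ennreal \<bar>kernel_op k f y\<bar> \<longrightarrow> q < kernel_int k (\<lambda>_. 1) y"
    using decomp
  proof eventually_elim
    case (elim y)
    show ?case
    proof (rule impI, rule ccontr)
      assume less: "\<tau> < e2ennreal \<bar>kernel_op k f y\<bar>" and "\<not> q < kernel_int k (\<lambda>_. 1) y"
      then have "kernel_int k (\<lambda>_. 1) y \<le> C * ennreal r"
        using \<open>q \<le> C * ennreal r\<close> by auto
      have "e2ennreal \<bar>kernel_op k f y\<bar> \<le> kernel_int k F y"
        unfolding F_def by (rule e2ennreal_abs_kernel_op_le)
      also have "\<dots> \<le> op_norm L1_norm Linf_norm (kernel_op k) * (\<integral>\<^sup>+ s. F s - a \<partial>halfline)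
         + a * kernel_int k (\<lambda>_. 1) y"
        by (rule elim)
      also have "\<dots> \<le> C * (\<integral>\<^sup>+ s. F s - a \<partial>halfline) + a * (C * ennreal r)"
        by (intro add_mono mult_mono C(2) order_refl \<open>kernel_int k (\<lambda>_. 1) y \<le> C * ennreal r\<close>) auto
      also have "\<dots> = \<tau>"
        by (simp add: \<tau>_def distrib_left mult.left_commute)
      finally show False using less by simp
    qed
  qed
  \<comment> \<open>The inclusion of superlevel sets holds up to a null set, which the measure does
    not see.\<close>
  then have "distr_fun halfline (\<lambda>y. e2ennreal \<bar>kernel_op k f y\<bar>) \<tau>
      \<le> distr_fun halfline (kernel_int k (\<lambda>_. 1)) q"
    unfolding distr_fun_def
  proof (intro emeasure_mono_AE)
    show "{y \<in> space halfline. q < kernel_int k (\<lambda>_. 1) y} \<in> sets halfline"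
      by measurable
  qed (auto elim!: eventually_mono)
  also have "\<dots> \<le> ennreal t"
    unfolding q_def by (rule distr_fun_decr_le) measurable
  finally have "rearr (kernel_op k f) t \<le> \<tau>"
    by (simp add: rearr_eq_decr decr_le_iff)
  also have "(\<integral>\<^sup>+ s. F s - a \<partial>halfline) + a * ennreal r
      = (\<integral>\<^sup>+ s \<in> {0<..<r}. decr_rearr halfline F (ennreal s) \<partial>lebesgue)"
    by (rule nn_integral_diff_decr[OF _ F r a_def a_fin])
      (intro sigma_finite_measure_restrict_space sigma_finite_lebesgue; simp)
  then have "\<tau> = C * (\<integral>\<^sup>+ s \<in> {0<..<1 / \<phi> t}. rearr f s \<partial>lebesgue)"
    by (simp add: \<tau>_def rearr_eq_decr F_def[abs_def] r_def)
  finally show ?thesis .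
qed

theorem theorem3p7:
  fixes k :: "real \<times> real \<Rightarrow> ennreal" and \<phi> :: "real \<Rightarrow> real" and C :: ennreal
  assumes "admissible_kernel k"
    and "\<And>t. 0 < t \<Longrightarrow> 0 < \<phi> t"
    and "mono_on {0<..} \<phi>"
    and "kernel_op_bounded k Linf_norm (m_norm \<phi>)"
    and "kernel_op_bounded k L1_norm Linf_norm"
    and "C = max (op_norm Linf_norm (m_norm \<phi>) (kernel_op k)) (op_norm L1_norm Linf_norm (kernel_op k))"
  shows "\<forall>f \<in> L1_plus_Linf.
      kernel_op_defined k f \<and> kernel_op k f \<in> measurable_functions \<and>
      (AE t in halfline.
         rearr (kernel_op k f) t \<le> C * (\<integral>\<^sup>+ s \<in> {0<..<1 / \<phi> t}. rearr f s \<partial>lebesgue)) \<and>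
      ((\<forall>t>0. continuous (at_right t) \<phi>) \<longrightarrow>
         (\<forall>t>0. rearr (kernel_op k f) t \<le> C * (\<integral>\<^sup>+ s \<in> {0<..<1 / \<phi> t}. rearr f s \<partial>lebesgue)))"
proof
  fix f assume f: "f \<in> L1_plus_Linf"
  have le: "rearr (kernel_op k f) t \<le> C * (\<integral>\<^sup>+ s \<in> {0<..<1 / \<phi> t}. rearr f s \<partial>lebesgue)"
    if "0 < t" for t
    using assms(6) by (intro rearr_kernel_op_le[OF assms(1,4,5,2,3) _ _ f that]) auto
  then have "AE t in halfline.
      rearr (kernel_op k f) t \<le> C * (\<integral>\<^sup>+ s \<in> {0<..<1 / \<phi> t}. rearr f s \<partial>lebesgue)"
    by (intro AE_I2) simp
  with le kernel_op_L1_plus_Linf[OF assms(1,4,5) f]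
  show "kernel_op_defined k f \<and> kernel_op k f \<in> measurable_functions \<and>
      (AE t in halfline.
         rearr (kernel_op k f) t \<le> C * (\<integral>\<^sup>+ s \<in> {0<..<1 / \<phi> t}. rearr f s \<partial>lebesgue)) \<and>
      ((\<forall>t>0. continuous (at_right t) \<phi>) \<longrightarrow>
         (\<forall>t>0. rearr (kernel_op k f) t \<le> C * (\<integral>\<^sup>+ s \<in> {0<..<1 / \<phi> t}. rearr f s \<partial>lebesgue)))"
    by blast
qed

end
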